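(* Let $d=(d_1,\ldots,d_n)$ be a vector with positive entries and let $D$ be the $n\times n$ diagonal matrix with diagonal entries $d_1,\ldots,d_n$. Let $$\mathcal{O}_d=\left\{M\begin{bmatrix}D&0\\0&D\end{bmatrix}M^T : M\in Sp(2n)\right\}$$ be the symplectic orbit of $\begin{bmatrix}D&0\\0&D\end{bmatrix}$ (i.e. the set of all $2n\times 2n$ real positive definite matrices whose symplectic eigenvalues, counted with multiplicity, are $d_1,\ldots,d_n$). Then the image of the map $\Delta_s:\mathcal{O}_d\to\mathbb{R}^n$ is exactly the set $\Sigma_d$.
   Context: Let $J=\begin{bmatrix}0 & I_n\\ -I_n & 0\end{bmatrix}$ and $Sp(2n)=\{M\in\mathbb{R}^{2n\times 2n}: M^TJM=J\}$. The symplectic eigenvalues of a $2n\times 2n$ real positive definite matrix $A$ are the diagonal entries of the positive diagonal matrix $D'$ such that $M^TAM=\begin{bmatrix}D'&0\\0&D'\end{bmatrix}$ for some $M\in Sp(2n)$ (Williamson's theorem; they are uniquely determined by $A$). For a $2n\times 2n$ real positive definite matrix $A=(a_{ij})$, define $\Delta_s(A)\in\mathbb{R}^n$ by $\Delta_s(A)_j=(a_{jj}\,a_{n+j,n+j})^{1/2}$, $1\le j\le n$. For $x,y\in\mathbb{R}^n$, $x$ is majorised by $y$, written $x\prec y$, if $\sum_{j=1}^k x_j^{\downarrow}\le\sum_{j=1}^k y_j^{\downarrow}$ for $1\le k\le n$ with equality for $k=n$, where $x_1^\downarrow\ge\cdots\ge x_n^\downarrow$ is the decreasing rearrangement. For $z,x\in\mathbb{R}^n$,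 $z\le x$ means $z_j\le x_j$ for all $j$. Define $$\Sigma_d=\bigcup_{z\prec d}\{x\in\mathbb{R}^n: z\le x\},$$ equivalently the set of $x$ with $\sum_{j=1}^k x_j^{\uparrow}\ge\sum_{j=1}^k d_j^{\uparrow}$ for $1\le k\le n$ (increasing rearrangements); it is the union of translates of the positive orthant $\mathbb{R}^n_+$ attached at each point of the convex hull of the coordinate permutations of $d$. *)

theory Defs
  imports "Jordan_Normal_Form.Matrix"
begin

definition J_mat :: "nat \<Rightarrow> real mat" where
  "J_mat n = four_block_mat (0\<^sub>m n n) (1\<^sub>m n) (- 1\<^sub>m n) (0\<^sub>m n n)"

definition Sp :: "nat \<Rightarrow> real mat set" where
  "Sp n = {M \<in> carrier_mat (2*n) (2*n). transpose_mat M * J_mat n * M = J_mat n}"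

definition diag_of :: "real list \<Rightarrow> real mat" where
  "diag_of d = mat (length d) (length d) (\<lambda>(i,j). if i = j then d ! i else 0)"

definition sympl_orbit :: "real list \<Rightarrow> real mat set" where
  "sympl_orbit d = (let n = length d; D = diag_of d in
     {M * four_block_mat D (0\<^sub>m n n) (0\<^sub>m n n) D * transpose_mat M | M. M \<in> Sp n})"

definition Delta_s :: "nat \<Rightarrow> real mat \<Rightarrow> real list" where
  "Delta_s n A = map (\<lambda>j. sqrt (A $$ (j,j) * A $$ (n+j, n+j))) [0..<n]"

definition decr :: "real list \<Rightarrow> real list" where
  "decr x = rev (sort x)"

definition majorised :: "real list \<Rightarrow> real list \<Rightarrow> bool" where
  "majorised x y \<longleftrightarrow> length x = length y \<and>
     (\<forall>k \<in> {1..length x}. sum_list (take k (decr x)) \<le> sum_list (take k (decr y))) \<and>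
     sum_list x = sum_list y"

definition le_vec :: "real list \<Rightarrow> real list \<Rightarrow> bool" where
  "le_vec z x \<longleftrightarrow> length z = length x \<and> (\<forall>j < length x. z ! j \<le> x ! j)"

definition Sigma_d :: "real list \<Rightarrow> real list set" where
  "Sigma_d d = (\<Union>z \<in> {z. majorised z d}. {x. le_vec z x})"

end

theory Submission
  imports Defs "Jordan_Normal_Form.Determinant"
begin

text \<open>Majorisation \<open>z \<prec> d\<close> is used in the form: equal sums, and
  \<open>\<Sum>\<^sub>j (z\<^sub>j - t)\<^sup>+ \<le> \<Sum>\<^sub>i (d\<^sub>i - t)\<^sup>+\<close> for every threshold \<open>t\<close>.

  For \<open>x = \<Delta>\<^sub>s(M diag(D, D) M\<^sup>T)\<close> a symplectic rescaling of the rows of \<open>M\<close> makes \<open>x\<^sub>j\<close> the arithmetic mean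
  of the two diagonal entries. The complex linear part \<open>\<alpha> = (M - J M J) / 2\<close> and the antilinear part
  \<open>\<beta> = (M + J M J) / 2\<close> satisfy \<open>\<alpha> \<alpha>\<^sup>T = 1 + \<beta> \<beta>\<^sup>T\<close>. So any set of \<open>2 k\<close> rows of \<open>\<alpha>\<close> has a Gram matrix
  above the identity and dominates the orthogonal projection onto its span, whose diagonal consists of
  weights in \<open>[0, 1]\<close> with sum \<open>2 k\<close>. Applied to the rows with \<open>x\<^sub>j < t\<close> this gives
  \<open>\<Sum>\<^sub>j (t - x\<^sub>j)\<^sup>+ \<le> \<Sum>\<^sub>i (t - d\<^sub>i)\<^sup>+\<close>, and then \<open>z\<^sub>j = min x\<^sub>j c\<close> with \<open>c\<close> chosen to match the sums is majorised
  by \<open>d\<close>.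

  Conversely, for \<open>z \<prec> d\<close> and \<open>z \<le> x\<close>, Horn's theorem gives an orthogonal \<open>Q\<close> such that \<open>Q D Q\<^sup>T\<close> has diagonal \<open>z\<close>,
  and shearing row \<open>j\<close> of \<open>diag(Q, Q)\<close> by \<open>s\<^sub>j\<close> times row \<open>n + j\<close> multiplies the \<open>j\<close>-th entry of \<open>\<Delta>\<^sub>s\<close>
  by \<open>sqrt (1 + s\<^sub>j\<^sup>2)\<close>.\<close>

section \<open>Majorisation by thresholds\<close>

definition maj_on :: "'a set \<Rightarrow> ('a \<Rightarrow> real) \<Rightarrow> ('a \<Rightarrow> real) \<Rightarrow> bool" where
  "maj_on R z y \<longleftrightarrow> sum z R = sum y R \<and>
     (\<forall>t. (\<Sum>i\<in>R. max 0 (z i - t)) \<le> (\<Sum>i\<in>R. max 0 (y i - t)))"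

text \<open>Together with \<open>maj_on_above\<close> this finds entries of \<open>y\<close> on both
  sides of the largest entry of \<open>z\<close>, so that a transfer can hit that value.\<close>

lemma maj_on_below:
  assumes "finite R" "R \<noteq> {}" "maj_on R z y"
  shows "\<exists>i\<in>R. y i \<le> Max (z ` R)"
proof (rule ccontr)
  assume "\<not> ?thesis"
  then have "\<And>i. i \<in> R \<Longrightarrow> z i < y i"
    using assms(1) by (meson Max_ge finite_imageI imageI le_less_trans not_le)
  then have "sum z R < sum y R" using assms by (intro sum_strict_mono) auto
  then show False using assms(3) by (simp add: maj_on_def)
qed

lemma maj_on_above:
  assumes "finite R" "j \<in> R" "maj_on R z y"
  shows "\<exists>i\<in>R. z j \<le> y i"
proof (rule ccontr)
  assume "\<not> ?thesis"
  then have lt: "\<And>i. i \<in> R \<Longrightarrow> y i < z j" by force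
  define m where "m = Max (y ` R)"
  have m: "m \<in> y ` R" using assms by (auto simp: m_def intro!: Max_in)
  have ym: "\<And>i. i \<in> R \<Longrightarrow> y i \<le> m" using assms by (auto simp: m_def)
  \<comment> \<open>At the threshold \<open>m\<close>, the largest entry of \<open>y\<close>, the
    right-hand side vanishes although \<open>z j\<close> exceeds \<open>m\<close>.\<close>
  have "(\<Sum>i\<in>R. max 0 (z i - m)) \<le> (\<Sum>i\<in>R. max 0 (y i - m))"
    using assms(3) by (simp add: maj_on_def)
  also have "\<dots> = 0" using ym by (intro sum.neutral) auto
  finally have "(\<Sum>i\<in>R. max 0 (z i - m)) \<le> 0" .
  moreover have "max 0 (z j - m) \<le> (\<Sum>i\<in>R. max 0 (z i - m))"
    using assms by (intro member_le_sum) auto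
  ultimately show False using m lt by force
qed

lemma sum_fun_upd2:
  fixes f :: "'a \<Rightarrow> real"
  assumes "finite R" "p \<in> R" "q \<in> R" "p \<noteq> q"
  shows "(\<Sum>i\<in>R. g ((f(p := a, q := b)) i)) = (\<Sum>i\<in>R - {p, q}. g (f i)) + (g a + g b :: real)"
    and "(\<Sum>i\<in>R. g (f i)) = (\<Sum>i\<in>R - {p, q}. g (f i)) + (g (f p) + g (f q))"
proof -
  have R: "R = insert p (insert q (R - {p, q}))" using assms by auto
  show "(\<Sum>i\<in>R. g ((f(p := a, q := b)) i)) = (\<Sum>i\<in>R - {p, q}. g (f i)) + (g a + g b)"
    by (subst R, subst sum.insert) (use assms in \<open>auto simp: sum.insert_remove intro!: sum.cong\<close>)
  show "(\<Sum>i\<in>R. g (f i)) = (\<Sum>i\<in>R - {p, q}. g (f i)) + (g (f p) + g (f q))"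
    by (subst R, subst sum.insert) (use assms in \<open>auto simp: sum.insert_remove\<close>)
qed

text \<open>The transfer lowers the threshold sum of \<open>y\<close> only for thresholds strictly
  between \<open>y p\<close> and \<open>y q\<close>. From \<open>z j\<close> on, the sum for
  \<open>z\<close> is zero. Below \<open>z j\<close>, no entry of \<open>y\<close> lies strictly
  between the two values, so the rest \<open>L\<close> of the sum is affine there and a count of
  entries decides.\<close>

lemma maj_on_adjacent:
  assumes fin: "finite R" and maj: "maj_on R z y"
    and j: "j \<in> R" "\<And>i. i \<in> R \<Longrightarrow> z i \<le> z j"
    and p: "p \<in> R" "y p < z j" and q: "q \<in> R" "z j < y q"
    and gap: "\<And>i. i \<in> R \<Longrightarrow> y i \<le> y p \<or> y q \<le> y i"
  shows "maj_on R z (y(p := z j, q := y p + y q - z j))"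
proof -
  define r where "r = y p + y q - z j"
  define y' where "y' = y(p := z j, q := r)"
  have pq: "p \<noteq> q" using p q by auto
  define L where "L t = (\<Sum>i\<in>R - {p, q}. max 0 (y i - t))" for t
  have Fy': "(\<Sum>i\<in>R. max 0 (y' i - t)) = L t + (max 0 (z j - t) + max 0 (r - t))" for t
    unfolding L_def y'_def using sum_fun_upd2(1)[OF fin p(1) q(1) pq, where g = "\<lambda>x. max 0 (x - t)"] by simp
  have Fy: "(\<Sum>i\<in>R. max 0 (y i - t)) = L t + (max 0 (y p - t) + max 0 (y q - t))" for t
    unfolding L_def using sum_fun_upd2(2)[OF fin p(1) q(1) pq, where g = "\<lambda>x. max 0 (x - t)"] by simp
  have le: "(\<Sum>i\<in>R. max 0 (z i - t)) \<le> (\<Sum>i\<in>R. max 0 (y i - t))" for t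
    using maj by (simp add: maj_on_def)
  have L0: "0 \<le> L t" for t unfolding L_def by (intro sum_nonneg) auto
  have "(\<Sum>i\<in>R. max 0 (z i - t)) \<le> (\<Sum>i\<in>R. max 0 (y' i - t))" for t
  proof -
    consider "t \<le> y p" | "z j \<le> t" | "y p < t" "t < z j" by linarith
    then show ?thesis
    proof cases
      case 1
      then show ?thesis using le[of t] p q unfolding Fy Fy' r_def by auto
    next
      case 2
      have "(\<Sum>i\<in>R. max 0 (z i - t)) = 0" using 2 j by (intro sum.neutral) force
      then show ?thesis unfolding Fy' using L0[of t] by auto
    next
      case 3
      define S where "S = {i \<in> R. t < z i}"
      define U where "U = {i \<in> R - {p, q}. y q \<le> y i}"
      have finS: "finite S" "finite U" using fin by (auto simp: S_def U_def)
      \<comment> \<open>By \<open>gap\<close>, exactly the entries indexed by \<open>U\<close>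
        contribute, so \<open>L\<close> has slope \<open>- card U\<close> on this interval.\<close>
      have LU: "L s = (\<Sum>i\<in>U. y i - s)" if "y p \<le> s" "s \<le> y q" for s
        unfolding L_def
      proof (rule sum.mono_neutral_cong_right)
        show "\<forall>i\<in>R - {p, q} - U. max 0 (y i - s) = 0"
          using gap that by (force simp: U_def)
      qed (use fin that in \<open>auto simp: U_def\<close>)
      have FS: "(\<Sum>i\<in>R. max 0 (z i - t)) = (\<Sum>i\<in>S. z i - t)"
        by (rule sum.mono_neutral_cong_right) (use fin in \<open>auto simp: S_def\<close>)
      show ?thesis
      proof (cases "card S \<le> card U + 1")
        case True
        \<comment> \<open>Few entries of \<open>z\<close> exceed \<open>t\<close>: each is at most
          \<open>z j\<close>, hence is paid for by an entry of \<open>U\<close> or by the new entry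
          \<open>z j\<close> at \<open>p\<close>.\<close>
        have "(\<Sum>i\<in>S. z i - t) \<le> (\<Sum>i\<in>S. z j - t)"
          using j by (intro sum_mono) (auto simp: S_def)
        also have "\<dots> = real (card S) * (z j - t)" by simp
        also have "\<dots> \<le> real (card U + 1) * (z j - t)"
          using True 3 by (intro mult_right_mono) auto
        also have "\<dots> = (\<Sum>i\<in>U. z j - t) + (z j - t)" by (simp add: algebra_simps)
        also have "(\<Sum>i\<in>U. z j - t) \<le> (\<Sum>i\<in>U. y i - t)"
          using q by (intro sum_mono) (auto simp: U_def)
        also have "\<dots> = L t" using LU[of t] 3 q by auto
        finally show ?thesis unfolding FS Fy' by (simp add: max_def split: if_splits)
      next
        case False
        \<comment> \<open>Many entries of \<open>z\<close> exceed \<open>t\<close>: the hypothesis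
          at the threshold \<open>y p\<close> is carried up to \<open>t\<close>. On the way the sum
          over \<open>S\<close> falls with slope \<open>card S\<close>, which is at least
          \<open>card U + 2\<close>.\<close>
        have Lp: "L (y p) = L t + real (card U) * (t - y p)"
          using LU[of t] LU[of "y p"] 3 q p by (simp add: sum_subtractf algebra_simps)
        have "(\<Sum>i\<in>S. z i - t) = (\<Sum>i\<in>S. z i - y p) - real (card S) * (t - y p)"
          by (simp add: sum_subtractf algebra_simps)
        also have "(\<Sum>i\<in>S. z i - y p) \<le> (\<Sum>i\<in>S. max 0 (z i - y p))" by (intro sum_mono) auto
        also have "\<dots> \<le> (\<Sum>i\<in>R. max 0 (z i - y p))"
          using fin by (intro sum_mono2) (auto simp: S_def)
        also have "\<dots> \<le> L (y p) + (y q - y p)" using le[of "y p"] Fy[of "y p"] p q by auto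
        also have "\<dots> = L t + real (card U) * (t - y p) + (y q - y p)" using Lp by simp
        finally have "(\<Sum>i\<in>S. z i - t) \<le> L t + (y q - y p) - (real (card S) - real (card U)) * (t - y p)"
          by (simp add: algebra_simps)
        also have "\<dots> \<le> L t + (y q - y p) - 2 * (t - y p)"
          using False 3 by (intro diff_left_mono mult_right_mono) auto
        also have "\<dots> = L t + ((z j - t) + (r - t))" by (simp add: r_def)
        finally show ?thesis unfolding FS Fy' by (simp add: max_def split: if_splits)
      qed
    qed
  qed
  moreover have "sum z R = sum y' R"
    using maj sum_fun_upd2(1)[OF fin p(1) q(1) pq, where g = "\<lambda>x. x" and f = y and a = "z j" and b = r]
      sum_fun_upd2(2)[OF fin p(1) q(1) pq, where g = "\<lambda>x. x" and f = y]
    by (simp add: maj_on_def y'_def r_def)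
  ultimately show ?thesis unfolding maj_on_def y'_def r_def by blast
qed

text \<open>Fixing the entries of \<open>z\<close> from the largest one downwards keeps the remaining entries
  majorised: the two entries of \<open>y\<close> that are moved are the neighbours of the target value.\<close>

lemma maj_on_transfer_closed:
  assumes closed: "\<And>y p q t. y \<in> X \<Longrightarrow> p \<in> T \<Longrightarrow> q \<in> T \<Longrightarrow> p \<noteq> q \<Longrightarrow> y p \<le> t \<Longrightarrow> t \<le> y q
      \<Longrightarrow> y(p := t, q := y p + y q - t) \<in> X"
    and "finite R" "R \<subseteq> T" "y \<in> X" "maj_on R z y" "\<And>i. i \<notin> R \<Longrightarrow> z i = y i"
  shows "z \<in> X"
  using assms(2-)
proof (induction "card R" arbitrary: R y)
  case 0
  then have "R = {}" by simp
  with 0 have "z = y" by auto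
  with 0 show ?case by simp
next
  case (Suc n)
  note fin = Suc.prems(1)
  have ne: "R \<noteq> {}" using Suc.hyps(2) by auto
  define M where "M = Max (z ` R)"
  have "M \<in> z ` R" using fin ne by (auto simp: M_def intro!: Max_in)
  then obtain j where j: "j \<in> R" "z j = M" by auto
  have jmax: "z i \<le> z j" if "i \<in> R" for i using that fin j by (auto simp: M_def)
  have "\<exists>y1. y1 \<in> X \<and> maj_on R z y1 \<and> (\<forall>i. i \<notin> R \<longrightarrow> z i = y1 i) \<and> (\<exists>p\<in>R. y1 p = z j)"
  proof (cases "\<exists>p\<in>R. y p = z j")
    case True
    with Suc.prems show ?thesis by blast
  next
    case False
    let ?A = "{i \<in> R. y i \<le> z j}" and ?B = "{i \<in> R. z j \<le> y i}"
    have A: "finite ?A" "?A \<noteq> {}"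
      using fin maj_on_below[OF fin ne Suc.prems(4)] j by (auto simp: M_def)
    have B: "finite ?B" "?B \<noteq> {}"
      using fin maj_on_above[OF fin j(1) Suc.prems(4)] by auto
    have "Max (y ` ?A) \<in> y ` ?A" using A by (intro Max_in) auto
    then obtain p where p: "p \<in> ?A" "y p = Max (y ` ?A)" by force
    have "Min (y ` ?B) \<in> y ` ?B" using B by (intro Min_in) auto
    then obtain q where q: "q \<in> ?B" "y q = Min (y ` ?B)" by force
    have pq: "y p < z j" "z j < y q" "p \<in> R" "q \<in> R" using p q False by force+
    have gap: "y i \<le> y p \<or> y q \<le> y i" if "i \<in> R" for i
    proof (cases "y i \<le> z j")
      case True
      then show ?thesis using A that by (simp add: p(2))
    next
      case False
      then show ?thesis using B that by (simp add: q(2))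
    qed
    let ?y1 = "y(p := z j, q := y p + y q - z j)"
    have "maj_on R z ?y1"
      by (rule maj_on_adjacent[OF fin Suc.prems(4) j(1)]) (use jmax pq gap in auto)
    moreover have "?y1 \<in> X"
      using closed[of y p q "z j"] Suc.prems pq by fastforce
    moreover have "\<exists>p\<in>R. ?y1 p = z j" using pq by force
    moreover have "\<forall>i. i \<notin> R \<longrightarrow> z i = ?y1 i" using pq Suc.prems(5) by auto
    ultimately show ?thesis by blast
  qed
  then obtain y1 p where y1: "y1 \<in> X" "maj_on R z y1" "\<And>i. i \<notin> R \<Longrightarrow> z i = y1 i"
    and p: "p \<in> R" "y1 p = z j" by blast
  \<comment> \<open>Swapping two values moves \<open>z j\<close> to its own index \<open>j\<close>.
    A swap is a transfer whose target \<open>t\<close> is one of the two old values, so it stays in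
    \<open>X\<close>.\<close>
  define y2 where "y2 = y1(p := y1 j, j := y1 p)"
  have y2X: "y2 \<in> X"
  proof (cases "p = j")
    case True
    then show ?thesis using y1 by (simp add: y2_def)
  next
    case False
    have "y1(p := y1 j, j := y1 p + y1 j - y1 j) \<in> X" if "y1 p \<le> y1 j"
      using closed[of y1 p j "y1 j"] y1 p j False Suc.prems that by auto
    moreover have "y1(j := y1 p, p := y1 j + y1 p - y1 p) \<in> X" if "y1 j \<le> y1 p"
      using closed[of y1 j p "y1 p"] y1 p j False Suc.prems that by auto
    ultimately show ?thesis using False fun_upd_twist[of p j y1 "y1 j" "y1 p"]
      by (cases "y1 p \<le> y1 j") (auto simp: y2_def)
  qed
  have sums: "(\<Sum>i\<in>R. g (y2 i)) = (\<Sum>i\<in>R. g (y1 i))" for g :: "real \<Rightarrow> real"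
  proof (cases "p = j")
    case False
    then show ?thesis
      using sum_fun_upd2(1)[OF fin p(1) j(1) False, where g = g and f = y1 and a = "y1 j" and b = "y1 p"]
        sum_fun_upd2(2)[OF fin p(1) j(1) False, where g = g and f = y1] by (simp add: y2_def)
  qed (simp add: y2_def)
  have y2j: "y2 j = z j" using p by (simp add: y2_def)
  have "maj_on (R - {j}) z y2"
    unfolding maj_on_def
  proof (intro conjI allI)
    show "sum z (R - {j}) = sum y2 (R - {j})"
      using sums[of "\<lambda>x. x"] y1(2) y2j fin j by (simp add: sum_diff1 maj_on_def)
    show "(\<Sum>i\<in>R - {j}. max 0 (z i - t)) \<le> (\<Sum>i\<in>R - {j}. max 0 (y2 i - t))" for t
      using sums[of "\<lambda>x. max 0 (x - t)"] y1(2) y2j fin j by (simp add: sum_diff1 maj_on_def)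
  qed
  moreover have "z i = y2 i" if "i \<notin> R - {j}" for i
    using that y1(3) y2j p j by (cases "i = j") (auto simp: y2_def)
  moreover have "n = card (R - {j})" using Suc.hyps(2) fin j by simp
  ultimately show ?case
    using Suc.hyps(1)[of "R - {j}" y2] Suc.prems y2X by auto
qed

text \<open>Capping \<open>x\<close> at \<open>c\<close> leaves the shortfall unchanged for
  \<open>t \<le> c\<close>. For larger \<open>t\<close> every capped entry is below
  \<open>t\<close>, so the shortfall is \<open>card R * t\<close> minus the common sum, which is at
  most the shortfall of \<open>y\<close>.\<close>

lemma maj_on_truncate:
  assumes fin: "finite R"
    and le: "\<And>t. (\<Sum>i\<in>R. max 0 (t - x i)) \<le> (\<Sum>i\<in>R. max 0 (t - y i))"
  obtains z where "maj_on R z y" "\<And>i. i \<in> R \<Longrightarrow> z i \<le> x i"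
proof (cases "R = {}")
  case True
  then show ?thesis using that[of x] by (simp add: maj_on_def)
next
  case False
  define s where "s = sum y R"
  have cont: "continuous_on UNIV (\<lambda>c. \<Sum>i\<in>R. min (x i) c)"
    by (intro continuous_intros)
  \<comment> \<open>Bracket for the intermediate value theorem: capping at the mean
    \<open>lo\<close> of \<open>y\<close> gives a sum of at most \<open>s\<close>, and capping at
    \<open>hi\<close> changes nothing.\<close>
  define lo where "lo = s / card R"
  define hi where "hi = Max (x ` R \<union> y ` R \<union> {lo})"
  have hi: "x i \<le> hi" "y i \<le> hi" if "i \<in> R" for i using that fin by (auto simp: hi_def)
  have lohi: "lo \<le> hi" using fin by (simp add: hi_def)
  have "(\<Sum>i\<in>R. min (x i) lo) \<le> (\<Sum>i\<in>R. lo)" by (intro sum_mono) auto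
  also have "\<dots> = s" using False fin by (simp add: lo_def)
  finally have 1: "(\<Sum>i\<in>R. min (x i) lo) \<le> s" .
  have "(\<Sum>i\<in>R. hi - x i) \<le> (\<Sum>i\<in>R. hi - y i)"
    using le[of hi] hi by (simp add: max_def cong: sum.cong)
  then have "s \<le> (\<Sum>i\<in>R. x i)" by (simp add: sum_subtractf s_def)
  also have "\<dots> = (\<Sum>i\<in>R. min (x i) hi)" using hi by (intro sum.cong) (auto simp: min_def)
  finally have 2: "s \<le> (\<Sum>i\<in>R. min (x i) hi)" .
  obtain c where c: "(\<Sum>i\<in>R. min (x i) c) = s"
    using IVT'[OF 1 2 lohi] cont continuous_on_subset by blast
  let ?z = "\<lambda>i. min (x i) c"
  have *: "(\<Sum>i\<in>R. max 0 (t - ?z i)) \<le> (\<Sum>i\<in>R. max 0 (t - y i))" for t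
  proof (cases "t \<le> c")
    case True
    then have "(\<Sum>i\<in>R. max 0 (t - ?z i)) = (\<Sum>i\<in>R. max 0 (t - x i))"
      by (intro sum.cong) auto
    then show ?thesis using le by simp
  next
    case False
    then have "(\<Sum>i\<in>R. max 0 (t - ?z i)) = (\<Sum>i\<in>R. t - ?z i)"
      by (intro sum.cong) auto
    also have "\<dots> = (\<Sum>i\<in>R. t - y i)" using c by (simp add: sum_subtractf s_def)
    also have "\<dots> \<le> (\<Sum>i\<in>R. max 0 (t - y i))" by (intro sum_mono) auto
    finally show ?thesis .
  qed
  \<comment> \<open>Since the sums agree, shortfalls below \<open>t\<close> and excesses above
    \<open>t\<close> differ by the same amount for both vectors.\<close>
  have flip: "(\<Sum>i\<in>R. max 0 (f i - t)) = (\<Sum>i\<in>R. max 0 (t - f i)) + sum f R - real (card R) * t"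
    for f :: "'a \<Rightarrow> real" and t :: real
  proof -
    have "(\<Sum>i\<in>R. max 0 (f i - t)) = (\<Sum>i\<in>R. max 0 (t - f i) + f i - t)"
      by (intro sum.cong) auto
    then show ?thesis by (simp add: sum.distrib sum_subtractf)
  qed
  have "(\<Sum>i\<in>R. max 0 (?z i - t)) \<le> (\<Sum>i\<in>R. max 0 (y i - t))" for t
    using *[of t] c flip[where f = ?z and t = t] flip[where f = y and t = t] by (simp add: s_def)
  then have "maj_on R ?z y"
    using c unfolding maj_on_def s_def by blast
  then show ?thesis by (rule that) auto
qed

section \<open>Prefix sums of decreasing lists and threshold sums\<close>

lemma sum_list_map_decr: "sum_list (map g (decr x)) = (\<Sum>i<length x. g (x ! i))"
proof -
  have "mset (decr x) = mset x" by (simp add: decr_def)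
  then have "sum_mset (mset (map g (decr x))) = sum_mset (mset (map g x))"
    by (simp only: mset_map)
  then have "sum_list (map g (decr x)) = sum_list (map g x)"
    by (simp only: sum_mset_sum_list)
  then show ?thesis by (simp add: sum_list_sum_nth atLeast0LessThan)
qed

text \<open>Each \<open>x\<close> is at most \<open>t + max 0 (x - t)\<close>, and the dropped
  entries have nonnegative excess. On decreasing lists the next two lemmas give the equality cases:
  \<open>t\<close> the last entry of the prefix, and \<open>k\<close> the number of entries above
  \<open>t\<close>.\<close>

lemma sum_list_take_le:
  fixes xs :: "real list"
  assumes "k \<le> length xs"
  shows "sum_list (take k xs) \<le> real k * t + (\<Sum>x\<leftarrow>xs. max 0 (x - t))"
proof -
  have "sum_list (take k xs) \<le> real k * t + (\<Sum>x\<leftarrow>take k xs. max 0 (x - t))"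
    using assms
  proof (induction xs arbitrary: k)
    case (Cons a xs)
    then show ?case by (cases k) (fastforce simp: algebra_simps)+
  qed simp
  also have "\<dots> \<le> real k * t + ((\<Sum>x\<leftarrow>take k xs. max 0 (x - t)) + (\<Sum>x\<leftarrow>drop k xs. max 0 (x - t)))"
    using sum_list_nonneg[of "map (\<lambda>x. max 0 (x - t)) (drop k xs)"] by force
  also have "\<dots> = real k * t + (\<Sum>x\<leftarrow>xs. max 0 (x - t))"
    by (metis append_take_drop_id map_append sum_list_append)
  finally show ?thesis .
qed

lemma sum_list_take_sorted_eq:
  fixes xs :: "real list"
  assumes "sorted_wrt (\<ge>) xs" "k \<in> {1..length xs}"
  shows "sum_list (take k xs) = real k * xs ! (k - 1) + (\<Sum>x\<leftarrow>xs. max 0 (x - xs ! (k - 1)))"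
proof -
  let ?t = "xs ! (k - 1)"
  have le: "\<And>i j. i \<le> j \<Longrightarrow> j < length xs \<Longrightarrow> xs ! j \<le> xs ! i"
    using assms(1) by (auto simp: sorted_wrt_iff_nth_less le_less)
  have 1: "?t \<le> x" if "x \<in> set (take k xs)" for x
    using that assms(2) le by (auto simp: in_set_conv_nth)
  have 2: "x \<le> ?t" if "x \<in> set (drop k xs)" for x
    using that assms(2) le[of "k - 1"] by (auto simp: in_set_conv_nth)
  have "(\<Sum>x\<leftarrow>xs. max 0 (x - ?t)) = (\<Sum>x\<leftarrow>take k xs. max 0 (x - ?t)) + (\<Sum>x\<leftarrow>drop k xs. max 0 (x - ?t))"
    by (metis append_take_drop_id map_append sum_list_append)
  also have "map (\<lambda>x. max 0 (x - ?t)) (take k xs) = map (\<lambda>x. x - ?t) (take k xs)"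
    using 1 by (intro map_cong) auto
  also have "map (\<lambda>x. max 0 (x - ?t)) (drop k xs) = map (\<lambda>x. 0) (drop k xs)"
    using 2 by (intro map_cong) auto
  also have "(\<Sum>x\<leftarrow>take k xs. x - ?t) = sum_list (take k xs) - real k * ?t"
    using assms(2) by (simp add: sum_list_subtractf sum_list_triv)
  finally show ?thesis by simp
qed

lemma sum_list_excess_sorted:
  fixes xs :: "real list"
  assumes "sorted_wrt (\<ge>) xs"
  shows "\<exists>k\<le>length xs. (\<Sum>x\<leftarrow>xs. max 0 (x - t)) = sum_list (take k xs) - real k * t"
  using assms
proof (induction xs)
  case (Cons a xs)
  show ?case
  proof (cases "t < a")
    case True
    from Cons obtain k where "k \<le> length xs"
      "(\<Sum>x\<leftarrow>xs. max 0 (x - t)) = sum_list (take k xs) - real k * t" by auto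
    with True show ?thesis by (intro exI[of _ "Suc k"]) (auto simp: algebra_simps)
  next
    case False
    then have "map (\<lambda>x. max 0 (x - t)) (a # xs) = map (\<lambda>x. 0) (a # xs)"
      using Cons.prems by (intro map_cong) force+
    then have "(\<Sum>x\<leftarrow>a # xs. max 0 (x - t)) = 0"
      by (simp only: sum_list_0)
    then show ?thesis by (intro exI[of _ 0]) simp
  qed
qed simp

lemma sorted_wrt_decr: "sorted_wrt (\<ge>) (decr x)"
  by (simp add: decr_def sorted_wrt_rev)

text \<open>Prefix sums and excess sums are dual. In each direction, one of the two lists uses the
  inequality \<open>sum_list_take_le\<close> and the other an equality case.\<close>

lemma majorised_iff_maj_on:
  "majorised z d \<longleftrightarrow> length z = length d \<and> maj_on {..<length d} ((!) z) ((!) d)"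
proof (cases "length z = length d")
  case len: True
  have ldecr: "length (decr x) = length x" for x by (simp add: decr_def)
  have excess: "(\<Sum>i<length d. max 0 (z ! i - t)) = (\<Sum>x\<leftarrow>decr z. max 0 (x - t))"
    "(\<Sum>i<length d. max 0 (d ! i - t)) = (\<Sum>x\<leftarrow>decr d. max 0 (x - t))" for t
    using len by (simp_all add: sum_list_map_decr)
  have sums: "sum_list z = (\<Sum>i<length d. z ! i)" "sum_list d = (\<Sum>i<length d. d ! i)"
    using len by (simp_all add: sum_list_sum_nth atLeast0LessThan)
  have "(\<forall>k\<in>{1..length z}. sum_list (take k (decr z)) \<le> sum_list (take k (decr d))) \<longleftrightarrow>
    (\<forall>t. (\<Sum>x\<leftarrow>decr z. max 0 (x - t)) \<le> (\<Sum>x\<leftarrow>decr d. max 0 (x - t)))" (is "?A \<longleftrightarrow> ?B")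
  proof
    assume A: ?A
    show ?B
    proof
      fix t
      obtain k where k: "k \<le> length (decr z)"
        "(\<Sum>x\<leftarrow>decr z. max 0 (x - t)) = sum_list (take k (decr z)) - real k * t"
        using sum_list_excess_sorted[OF sorted_wrt_decr] by blast
      \<comment> \<open>For \<open>k = 0\<close>, outside the range of \<open>A\<close>, both
        prefixes are empty.\<close>
      have "sum_list (take k (decr z)) \<le> sum_list (take k (decr d))"
        using A k(1) by (cases "k = 0") (auto simp: ldecr)
      then show "(\<Sum>x\<leftarrow>decr z. max 0 (x - t)) \<le> (\<Sum>x\<leftarrow>decr d. max 0 (x - t))"
        using sum_list_take_le[of k "decr d" t] k len by (simp add: ldecr)
    qed
  next
    assume B: ?B
    show ?A
    proof
      fix k assume k: "k \<in> {1..length z}"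
      let ?t = "decr d ! (k - 1)"
      have "sum_list (take k (decr z)) \<le> real k * ?t + (\<Sum>x\<leftarrow>decr z. max 0 (x - ?t))"
        using k by (intro sum_list_take_le) (simp add: ldecr)
      also have "\<dots> \<le> real k * ?t + (\<Sum>x\<leftarrow>decr d. max 0 (x - ?t))" using B by simp
      also have "\<dots> = sum_list (take k (decr d))"
        using k len by (intro sum_list_take_sorted_eq[symmetric] sorted_wrt_decr) (simp add: ldecr)
      finally show "sum_list (take k (decr z)) \<le> sum_list (take k (decr d))" .
    qed
  qed
  then show ?thesis unfolding majorised_def maj_on_def excess sums using len by blast
qed (simp add: majorised_def)

section \<open>Horn's theorem\<close>

definition orthonormal_rows :: "nat \<Rightarrow> (nat \<Rightarrow> nat \<Rightarrow> real) \<Rightarrow> bool" where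
  "orthonormal_rows n q \<longleftrightarrow> (\<forall>j<n. \<forall>k<n. (\<Sum>i<n. q j i * q k i) = of_bool (j = k))"

text \<open>These are the diagonals of \<open>Q D Q^T\<close> with \<open>Q\<close> orthogonal,
  where \<open>q j\<close> is row \<open>j\<close> of \<open>Q\<close>; values of \<open>y\<close>
  from \<open>n\<close> on are free.\<close>

definition orbit_diagonals :: "nat \<Rightarrow> (nat \<Rightarrow> real) \<Rightarrow> (nat \<Rightarrow> real) set" where
  "orbit_diagonals n d = {y. \<exists>q. orthonormal_rows n q \<and> (\<forall>j<n. y j = (\<Sum>i<n. d i * (q j i)\<^sup>2))}"

lemma orthonormal_rows_rotate:
  assumes q: "orthonormal_rows n q" and ab: "a < n" "b < n" "a \<noteq> b" and cs: "c\<^sup>2 + s\<^sup>2 = 1"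
  shows "orthonormal_rows n (q(a := \<lambda>i. c * q a i + s * q b i, b := \<lambda>i. - s * q a i + c * q b i))"
    (is "orthonormal_rows n ?q'")
proof -
  let ?ip = "\<lambda>u v. \<Sum>i<n. u i * v i :: real"
  have ip: "?ip (q j) (q k) = of_bool (j = k)" if "j < n" "k < n" for j k
    using q that by (simp add: orthonormal_rows_def)
  have lin: "?ip u (\<lambda>i. x * v i + y * w i) = x * ?ip u v + y * ?ip u w"
    "?ip (\<lambda>i. x * v i + y * w i) u = x * ?ip v u + y * ?ip w u"
    "?ip u (\<lambda>i. x * v i - y * w i) = x * ?ip u v - y * ?ip u w"
    "?ip (\<lambda>i. x * v i - y * w i) u = x * ?ip v u - y * ?ip w u" for u v w x y
    by (simp_all add: sum.distrib sum_subtractf sum_distrib_left algebra_simps)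
  show ?thesis
    unfolding orthonormal_rows_def
  proof (intro allI impI)
    fix j k assume jk: "j < n" "k < n"
    show "?ip (?q' j) (?q' k) = of_bool (j = k)"
      using jk ab cs
      by (cases "j = a"; cases "j = b"; cases "k = a"; cases "k = b")
         (simp_all add: lin ip power2_eq_square)
  qed
qed

text \<open>Rotating the rows \<open>a\<close> and \<open>b\<close> by an angle from
  \<open>0\<close> to \<open>pi / 2\<close> moves diagonal entry \<open>a\<close> continuously from
  \<open>y a\<close> to \<open>y b\<close>, while the sum of the two entries stays fixed.\<close>

lemma orbit_diagonals_transfer:
  assumes y: "y \<in> orbit_diagonals n d" and ab: "a < n" "b < n" "a \<noteq> b"
    and t: "y a \<le> t" "t \<le> y b"
  shows "y(a := t, b := y a + y b - t) \<in> orbit_diagonals n d"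
proof -
  obtain q where q: "orthonormal_rows n q" and yq: "\<And>j. j < n \<Longrightarrow> y j = (\<Sum>i<n. d i * (q j i)\<^sup>2)"
    using y by (auto simp: orbit_diagonals_def)
  \<comment> \<open>The off-diagonal entry of \<open>Q D Q^T\<close> at
    \<open>(a, b)\<close>.\<close>
  define B where "B = (\<Sum>i<n. d i * (q a i * q b i))"
  have diag: "(\<Sum>i<n. d i * (c * q a i + s * q b i)\<^sup>2) = c\<^sup>2 * y a + 2 * c * s * B + s\<^sup>2 * y b" for c s
    unfolding B_def using ab
    by (simp add: yq sum_distrib_left sum.distrib[symmetric] power2_eq_square algebra_simps)
  define f where "f \<theta> = (cos \<theta>)\<^sup>2 * y a + 2 * cos \<theta> * sin \<theta> * B + (sin \<theta>)\<^sup>2 * y b" for \<theta>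
  have "\<exists>\<theta>. 0 \<le> \<theta> \<and> \<theta> \<le> pi / 2 \<and> f \<theta> = t"
    by (rule IVT') (use t in \<open>auto simp: f_def intro!: continuous_intros\<close>)
  then obtain \<theta> where \<theta>: "f \<theta> = t" by blast
  define c s where "c = cos \<theta>" and "s = sin \<theta>"
  have cs: "c\<^sup>2 + s\<^sup>2 = 1" by (simp add: c_def s_def)
  let ?q' = "q(a := \<lambda>i. c * q a i + s * q b i, b := \<lambda>i. - s * q a i + c * q b i)"
  have 1: "(\<Sum>i<n. d i * (c * q a i + s * q b i)\<^sup>2) = t"
    using \<theta> by (simp add: diag f_def c_def s_def)
  have "(\<Sum>i<n. d i * (- s * q a i + c * q b i)\<^sup>2) = s\<^sup>2 * y a - 2 * s * c * B + c\<^sup>2 * y b"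
    using diag[of "- s" c] by simp
  also have "\<dots> = (c\<^sup>2 + s\<^sup>2) * (y a + y b) - (c\<^sup>2 * y a + 2 * c * s * B + s\<^sup>2 * y b)"
    by (simp add: algebra_simps)
  also have "\<dots> = y a + y b - t" using 1 cs unfolding diag by simp
  finally have 2: "(\<Sum>i<n. d i * (- s * q a i + c * q b i)\<^sup>2) = y a + y b - t" .
  have "\<forall>j<n. (y(a := t, b := y a + y b - t)) j = (\<Sum>i<n. d i * (?q' j i)\<^sup>2)"
    using 1 2 yq ab by simp
  then show ?thesis
    using orthonormal_rows_rotate[OF q ab cs] unfolding orbit_diagonals_def by blast
qed

lemma schur_horn_existence:
  assumes "maj_on {..<n} z d"
  obtains q where "orthonormal_rows n q" "\<And>j. j < n \<Longrightarrow> z j = (\<Sum>i<n. d i * (q j i)\<^sup>2)"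
proof -
  \<comment> \<open>\<open>maj_on_transfer_closed\<close> needs agreement with the starting point
    \<open>d\<close> outside the index set.\<close>
  let ?z = "\<lambda>i. if i < n then z i else d i"
  have eq: "of_bool (j = i) * x = (if j = i then x else 0)"
    "x * (of_bool (j = i))\<^sup>2 = (if j = i then x else 0)" for i j :: nat and x :: real by simp_all
  have "orthonormal_rows n (\<lambda>j i. of_bool (j = i))"
    unfolding orthonormal_rows_def eq by auto
  moreover have "\<forall>j<n. d j = (\<Sum>i<n. d i * (of_bool (j = i))\<^sup>2)"
    unfolding eq by simp
  ultimately have d: "d \<in> orbit_diagonals n d" unfolding orbit_diagonals_def by blast
  have "?z \<in> orbit_diagonals n d"
    by (rule maj_on_transfer_closed[of _ "{..<n}" "{..<n}" d])
       (use orbit_diagonals_transfer d assms in \<open>auto simp: maj_on_def\<close>)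
  then show ?thesis using that by (auto simp: orbit_diagonals_def)
qed

section \<open>Weights from a Gram matrix above the identity\<close>

lemma gram_diag:
  fixes X :: "real mat"
  assumes "X \<in> carrier_mat m n" "i < n"
  shows "(X\<^sup>T * X) $$ (i, i) = (\<Sum>r<m. (X $$ (r, i))\<^sup>2)"
  using assms by (auto simp: scalar_prod_def power2_eq_square atLeast0LessThan)

text \<open>A kernel vector \<open>v\<close> would satisfy
  \<open>|v|^2 + |B^T v|^2 = 0\<close>.\<close>

lemma one_plus_gram_invertible:
  fixes B :: "real mat"
  assumes B: "B \<in> carrier_mat m n"
  obtains H where "H \<in> carrier_mat m m" "(1\<^sub>m m + B * B\<^sup>T) * H = 1\<^sub>m m" "H * (1\<^sub>m m + B * B\<^sup>T) = 1\<^sub>m m"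
proof -
  let ?G = "1\<^sub>m m + B * B\<^sup>T"
  have G: "?G \<in> carrier_mat m m" using B by simp
  have "det ?G \<noteq> 0"
  proof
    assume "det ?G = 0"
    then obtain v where v: "v \<in> carrier_vec m" "v \<noteq> 0\<^sub>v m" "?G *\<^sub>v v = 0\<^sub>v m"
      using det_0_iff_vec_prod_zero[OF G] by blast
    have Bv: "B\<^sup>T *\<^sub>v v \<in> carrier_vec n" using B v by (intro mult_mat_vec_carrier[of _ n m]) auto
    have "?G *\<^sub>v v = v + B *\<^sub>v (B\<^sup>T *\<^sub>v v)"
      using B v by (simp add: add_mult_distrib_mat_vec[of _ m m] assoc_mult_mat_vec[of B m n _ m])
    then have "0 = v \<bullet> (v + B *\<^sub>v (B\<^sup>T *\<^sub>v v))"
      using v by (metis scalar_prod_right_zero)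
    also have "\<dots> = v \<bullet> v + v \<bullet> (B *\<^sub>v (B\<^sup>T *\<^sub>v v))"
      using v B by (intro scalar_prod_add_distrib[of _ m]) auto
    also have "v \<bullet> (B *\<^sub>v (B\<^sup>T *\<^sub>v v)) = (B\<^sup>T *\<^sub>v v) \<bullet> (B\<^sup>T *\<^sub>v v)"
      using transpose_vec_mult_scalar[OF B Bv v(1)] by (rule sym)
    finally have "v \<bullet> v + (B\<^sup>T *\<^sub>v v) \<bullet> (B\<^sup>T *\<^sub>v v) = 0" by simp
    moreover have nonneg: "0 \<le> u \<bullet> u" for u :: "real vec"
      by (auto simp: scalar_prod_def intro!: sum_nonneg)
    ultimately have "v \<bullet> v = 0" using nonneg[of v] nonneg[of "B\<^sup>T *\<^sub>v v"] by linarith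
    then have "\<forall>i\<in>{0..<m}. v $ i * v $ i = 0"
      using v(1) by (simp add: scalar_prod_def sum_nonneg_eq_0_iff)
    then have "v = 0\<^sub>v m" using v(1) by (intro eq_vecI) auto
    then show False using v by simp
  qed
  from det_non_zero_imp_unit[OF G this, unfolded Units_def, of "()"]
  show ?thesis using that by (auto simp: ring_mat_def)
qed

text \<open>The weights are the diagonal of the orthogonal projection \<open>A\<^sup>T (A A\<^sup>T)\<^sup>-\<^sup>1 A\<close>
  onto the row space of \<open>A\<close>.\<close>

lemma projection_weights_mat:
  fixes A B :: "real mat"
  assumes A: "A \<in> carrier_mat m n" and B: "B \<in> carrier_mat m l"
    and AB: "A * A\<^sup>T = 1\<^sub>m m + B * B\<^sup>T"
  obtains w where "\<And>i. i < n \<Longrightarrow> 0 \<le> w i" "\<And>i. i < n \<Longrightarrow> w i \<le> 1"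
    "\<And>i. i < n \<Longrightarrow> w i \<le> (\<Sum>r<m. (A $$ (r, i))\<^sup>2)" "(\<Sum>i<n. w i) = real m"
proof -
  define G where "G = A * A\<^sup>T"
  have G: "G \<in> carrier_mat m m" using A by (simp add: G_def)
  obtain H where H: "H \<in> carrier_mat m m" and GH: "G * H = 1\<^sub>m m" and HG: "H * G = 1\<^sub>m m"
    using one_plus_gram_invertible[OF B] by (metis AB G_def)
  have "H\<^sup>T = H"
  proof -
    have Gt: "G\<^sup>T = G" unfolding G_def using A by (subst transpose_mult[of _ m n _ m]) auto
    have "H\<^sup>T * G = 1\<^sub>m m" using arg_cong[OF GH, of transpose_mat] G H
      by (subst (asm) transpose_mult[of _ m m _ m]) (auto simp: Gt)
    then have "H\<^sup>T * (G * H) = H" using G H by (subst assoc_mult_mat[symmetric, of _ m m _ m _ m]) auto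
    then show ?thesis using H by (simp add: GH)
  qed
  define W where "W = H * A"
  have W: "W \<in> carrier_mat m n" using H A by (simp add: W_def)
  have GW: "G * W = A" unfolding W_def using G H A GH
    by (subst assoc_mult_mat[symmetric, of _ m m _ m _ n]) auto
  have WA: "W * A\<^sup>T = 1\<^sub>m m" unfolding W_def using G H A HG
    by (subst assoc_mult_mat[of _ m m _ n _ m]) (auto simp: G_def)
  define P where "P = A\<^sup>T * W"
  have P: "P \<in> carrier_mat n n" using A W by (simp add: P_def)
  have Wt: "W\<^sup>T = A\<^sup>T * H" unfolding W_def using H A \<open>H\<^sup>T = H\<close>
    by (subst transpose_mult[of _ m m _ n]) auto
  have Pt: "P\<^sup>T = P"
  proof -
    have "P\<^sup>T = W\<^sup>T * A" unfolding P_def using A W by (subst transpose_mult[of _ n m _ n]) auto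
    also have "\<dots> = A\<^sup>T * (H * A)" unfolding Wt using A H by (intro assoc_mult_mat[of _ n m _ m _ n]) auto
    also have "\<dots> = P" by (simp add: P_def W_def)
    finally show ?thesis .
  qed
  have PP: "P * P = P"
  proof -
    have "P * P = A\<^sup>T * (W * (A\<^sup>T * W))" unfolding P_def using A W
      by (intro assoc_mult_mat[of _ n m _ n _ n]) auto
    also have "W * (A\<^sup>T * W) = W * A\<^sup>T * W" using A W
      by (intro assoc_mult_mat[symmetric, of _ m n _ m _ n]) auto
    also have "\<dots> = W" using WA W by simp
    finally show ?thesis by (simp add: P_def)
  qed
  define w where "w i = P $$ (i, i)" for i
  \<comment> \<open>\<open>P\<close> is symmetric and idempotent, so \<open>w i\<close> is the
    squared norm of column \<open>i\<close>. It contains the square of \<open>w i\<close> itself,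
    whence \<open>w i \<le> 1\<close>.\<close>
  have wsq: "w i = (\<Sum>j<n. (P $$ (j, i))\<^sup>2)" if "i < n" for i
    using gram_diag[OF P that] by (simp add: Pt PP w_def)
  have w0: "0 \<le> w i" if "i < n" for i using that by (simp add: wsq sum_nonneg)
  have w1: "w i \<le> 1" if "i < n" for i
  proof (rule ccontr)
    assume "\<not> w i \<le> 1"
    then have "w i * 1 < w i * w i" by (intro mult_strict_left_mono) auto
    moreover have "(P $$ (i, i))\<^sup>2 \<le> (\<Sum>j<n. (P $$ (j, i))\<^sup>2)"
      using that by (intro member_le_sum) auto
    ultimately show False using wsq[OF that] by (simp add: w_def power2_eq_square)
  qed
  have wA: "w i \<le> (\<Sum>r<m. (A $$ (r, i))\<^sup>2)" if i: "i < n" for i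
  proof -
    \<comment> \<open>From \<open>A = G W = W + E\<close> one gets
      \<open>A^T A = P + F^T F + E^T E\<close>, and the last two Gram matrices have nonnegative
      diagonals.\<close>
    define F where "F = B\<^sup>T * W"
    define E where "E = B * F"
    have F: "F \<in> carrier_mat l n" and E: "E \<in> carrier_mat m n"
      using B W by (simp_all add: F_def E_def)
    have AWE: "A = W + E"
    proof -
      have "A = (1\<^sub>m m + B * B\<^sup>T) * W" using GW by (simp add: G_def AB)
      also have "\<dots> = W + B * B\<^sup>T * W" using B W
        by (subst add_mult_distrib_mat[of _ m m _ _ n]) auto
      also have "B * B\<^sup>T * W = E" unfolding E_def F_def using B W
        by (intro assoc_mult_mat[of _ m l _ m _ n]) auto
      finally show ?thesis .
    qed
    have WE: "W\<^sup>T * E = F\<^sup>T * F"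
    proof -
      have "F\<^sup>T = W\<^sup>T * B" unfolding F_def using B W by (subst transpose_mult[of _ l m _ n]) auto
      then show ?thesis unfolding E_def using B W F
        by (simp add: assoc_mult_mat[of _ n m _ l _ n])
    qed
    have "A\<^sup>T * A = A\<^sup>T * W + A\<^sup>T * E"
      by (subst (2) AWE, rule mult_add_distrib_mat[of _ n m]) (use A W E in auto)
    also have "A\<^sup>T * E = (W\<^sup>T + E\<^sup>T) * E"
      by (subst AWE, subst transpose_add[OF W E]) (rule refl)
    also have "\<dots> = F\<^sup>T * F + E\<^sup>T * E"
      using W E WE by (subst add_mult_distrib_mat[of _ n m _ _ n]) auto
    finally have eq: "A\<^sup>T * A = P + (F\<^sup>T * F + E\<^sup>T * E)" by (simp add: P_def)
    have "(A\<^sup>T * A) $$ (i, i) = w i + ((F\<^sup>T * F) $$ (i, i) + (E\<^sup>T * E) $$ (i, i))"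
      unfolding eq w_def using i P E F by simp
    then have "(\<Sum>r<m. (A $$ (r, i))\<^sup>2) = w i + ((\<Sum>r<l. (F $$ (r, i))\<^sup>2) + (\<Sum>r<m. (E $$ (r, i))\<^sup>2))"
      using gram_diag[OF A i] gram_diag[OF F i] gram_diag[OF E i] by simp
    then show ?thesis by (simp add: sum_nonneg)
  qed
  \<comment> \<open>The trace of \<open>A^T W\<close> equals that of \<open>W A^T\<close>, which is
    the identity of size \<open>m\<close>.\<close>
  have "(\<Sum>i<n. w i) = (\<Sum>i<n. \<Sum>r<m. A $$ (r, i) * W $$ (r, i))"
    using A W by (auto simp: w_def P_def scalar_prod_def atLeast0LessThan)
  also have "\<dots> = (\<Sum>r<m. \<Sum>i<n. A $$ (r, i) * W $$ (r, i))" by (rule sum.swap)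
  also have "\<dots> = (\<Sum>r<m. (W * A\<^sup>T) $$ (r, r))"
    using A W by (auto simp: scalar_prod_def atLeast0LessThan mult.commute intro!: sum.cong)
  also have "\<dots> = real m" by (simp add: WA)
  finally show ?thesis using that w0 w1 wA by blast
qed

text \<open>Enumerating rows and columns frees the result from initial segments of the naturals; it
  is applied to pairs of a block and an index.\<close>

lemma projection_weights:
  fixes a b :: "'r \<Rightarrow> 'c \<Rightarrow> real"
  assumes fin: "finite S" "finite I"
    and gram: "\<And>r s. r \<in> S \<Longrightarrow> s \<in> S \<Longrightarrow>
      (\<Sum>i\<in>I. a r i * a s i) = of_bool (r = s) + (\<Sum>i\<in>I. b r i * b s i)"
  obtains w where "\<And>i. i \<in> I \<Longrightarrow> 0 \<le> w i" "\<And>i. i \<in> I \<Longrightarrow> w i \<le> 1"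
    "\<And>i. i \<in> I \<Longrightarrow> w i \<le> (\<Sum>r\<in>S. (a r i)\<^sup>2)" "sum w I = real (card S)"
proof -
  obtain f where f: "bij_betw f {..<card S} S"
    using ex_bij_betw_nat_finite[OF fin(1)] by (auto simp: atLeast0LessThan)
  obtain g where g: "bij_betw g {..<card I} I"
    using ex_bij_betw_nat_finite[OF fin(2)] by (auto simp: atLeast0LessThan)
  define m n where "m = card S" and "n = card I"
  note f = f[folded m_def] and g = g[folded n_def]
  define A where "A = mat m n (\<lambda>(r, i). a (f r) (g i))"
  define B where "B = mat m n (\<lambda>(r, i). b (f r) (g i))"
  have AB: "A \<in> carrier_mat m n" "B \<in> carrier_mat m n" by (simp_all add: A_def B_def)
  have fS: "f r \<in> S" if "r < m" for r using f that by (auto simp: bij_betw_def)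
  have finj: "f r = f s \<longleftrightarrow> r = s" if "r < m" "s < m" for r s
    using f that by (auto simp: bij_betw_def inj_on_def)
  have reindex: "(\<Sum>i<n. h (g i)) = sum h I" for h :: "'c \<Rightarrow> real"
    by (rule sum.reindex_bij_betw[OF g])
  have "A * A\<^sup>T = 1\<^sub>m m + B * B\<^sup>T"
  proof (rule eq_matI)
    fix r s assume "r < dim_row (1\<^sub>m m + B * B\<^sup>T)" "s < dim_col (1\<^sub>m m + B * B\<^sup>T)"
    then have rs: "r < m" "s < m" by (simp_all add: B_def)
    have "(A * A\<^sup>T) $$ (r, s) = (\<Sum>i<n. a (f r) (g i) * a (f s) (g i))"
      using rs by (simp add: A_def scalar_prod_def atLeast0LessThan)
    also have "\<dots> = of_bool (r = s) + (\<Sum>i<n. b (f r) (g i) * b (f s) (g i))"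
      using gram[OF fS fS, OF rs] finj[OF rs] reindex[of "\<lambda>i. a (f r) i * a (f s) i"]
        reindex[of "\<lambda>i. b (f r) i * b (f s) i"] by simp
    also have "\<dots> = (1\<^sub>m m + B * B\<^sup>T) $$ (r, s)"
      using rs by (simp add: B_def scalar_prod_def atLeast0LessThan)
    finally show "(A * A\<^sup>T) $$ (r, s) = (1\<^sub>m m + B * B\<^sup>T) $$ (r, s)" .
  qed (simp_all add: A_def B_def)
  then obtain w where w: "\<And>i. i < n \<Longrightarrow> 0 \<le> w i" "\<And>i. i < n \<Longrightarrow> w i \<le> 1"
    "\<And>i. i < n \<Longrightarrow> w i \<le> (\<Sum>r<m. (A $$ (r, i))\<^sup>2)" "(\<Sum>i<n. w i) = real m"
    using projection_weights_mat[OF AB] by metis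
  define g' where "g' = the_inv_into {..<n} g"
  have g': "bij_betw g' I {..<n}" unfolding g'_def by (rule bij_betw_the_inv_into[OF g])
  have gg': "g' i < n" "g (g' i) = i" if "i \<in> I" for i
    using g' g that by (auto simp: bij_betw_def g'_def f_the_inv_into_f)
  show ?thesis
  proof (rule that[of "\<lambda>i. w (g' i)"])
    fix i assume i: "i \<in> I"
    show "0 \<le> w (g' i)" "w (g' i) \<le> 1" using w gg'(1)[OF i] by auto
    have "w (g' i) \<le> (\<Sum>r<m. (A $$ (r, g' i))\<^sup>2)" using w(3) gg'(1)[OF i] .
    also have "\<dots> = (\<Sum>r<m. (a (f r) i)\<^sup>2)" using gg'[OF i] by (simp add: A_def)
    also have "\<dots> = (\<Sum>r\<in>S. (a r i)\<^sup>2)" by (rule sum.reindex_bij_betw[OF f])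
    finally show "w (g' i) \<le> (\<Sum>r\<in>S. (a r i)\<^sup>2)" .
  next
    show "(\<Sum>i\<in>I. w (g' i)) = real (card S)"
      using sum.reindex_bij_betw[OF g', of w] w(4) by (simp add: m_def)
  qed
qed

section \<open>Symplectic diagonals\<close>

text \<open>In the difference of the Gram matrices of \<open>a\<close> and \<open>b\<close> only
  symplectic products of rows survive. Within one block these are given by \<open>AE\<close>, across
  blocks by \<open>AB\<close> and \<open>CE\<close>.\<close>

lemma symplectic_rows_weights:
  fixes A B C E :: "nat \<Rightarrow> nat \<Rightarrow> real"
  assumes fin: "finite K"
    and AB: "\<And>j k. j \<in> K \<Longrightarrow> k \<in> K \<Longrightarrow> (\<Sum>i<n. A j i * B k i - B j i * A k i) = 0"
    and CE: "\<And>j k. j \<in> K \<Longrightarrow> k \<in> K \<Longrightarrow> (\<Sum>i<n. C j i * E k i - E j i * C k i) = 0"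
    and AE: "\<And>j k. j \<in> K \<Longrightarrow> k \<in> K \<Longrightarrow> (\<Sum>i<n. A j i * E k i - B j i * C k i) = of_bool (j = k)"
  obtains v where "\<And>i. i < n \<Longrightarrow> 0 \<le> v i" "\<And>i. i < n \<Longrightarrow> v i \<le> 1"
    "\<And>i. i < n \<Longrightarrow> v i \<le> (\<Sum>j\<in>K. ((A j i)\<^sup>2 + (B j i)\<^sup>2 + (C j i)\<^sup>2 + (E j i)\<^sup>2) / 2)"
    "(\<Sum>i<n. v i) = real (card K)"
proof -
  \<comment> \<open>The index \<open>(False, j)\<close> stands for \<open>j\<close> and \<open>(True, j)\<close> for \<open>n + j\<close>; \<open>a\<close> and \<open>b\<close> are the complex linear
    and antilinear parts of the block matrix with rows \<open>A B\<close> and \<open>C E\<close>.\<close>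
  define a :: "bool \<times> nat \<Rightarrow> bool \<times> nat \<Rightarrow> real" where
    "a = (\<lambda>(s, j) (c, i). if s = c then (A j i + E j i) / 2
      else if c then (B j i - C j i) / 2 else (C j i - B j i) / 2)"
  define b :: "bool \<times> nat \<Rightarrow> bool \<times> nat \<Rightarrow> real" where
    "b = (\<lambda>(s, j) (c, i). if s \<noteq> c then (B j i + C j i) / 2
      else if c then (E j i - A j i) / 2 else (A j i - E j i) / 2)"
  let ?S = "(UNIV :: bool set) \<times> K" and ?I = "(UNIV :: bool set) \<times> {..<n}"
  have split: "sum g (UNIV \<times> X) = (\<Sum>x\<in>X. g (False, x) + g (True, x))" if "finite X"
    for g :: "bool \<times> nat \<Rightarrow> real" and X
    using sum.cartesian_product[of "\<lambda>c x. g (c, x)" X UNIV] by (simp add: UNIV_bool sum.distrib)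
  have gram: "(\<Sum>i\<in>?I. a r i * a s i) = of_bool (r = s) + (\<Sum>i\<in>?I. b r i * b s i)"
    if rs: "r \<in> ?S" "s \<in> ?S" for r s
  proof -
    obtain x j where r: "r = (x, j)" "j \<in> K" using rs by auto
    obtain y k where s: "s = (y, k)" "k \<in> K" using rs by auto
    note rel = AB[OF r(2) s(2)] CE[OF r(2) s(2)] AE[OF r(2) s(2)] AE[OF s(2) r(2)]
    let ?ab = "\<lambda>i. A j i * B k i - B j i * A k i" and ?ce = "\<lambda>i. C j i * E k i - E j i * C k i"
    let ?ae = "\<lambda>i. A j i * E k i - B j i * C k i" and ?ea = "\<lambda>i. A k i * E j i - B k i * C j i"
    have diff: "(\<Sum>i\<in>?I. a r i * a s i) - (\<Sum>i\<in>?I. b r i * b s i)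
        = (\<Sum>i<n. (a r (False, i) * a s (False, i) - b r (False, i) * b s (False, i))
          + (a r (True, i) * a s (True, i) - b r (True, i) * b s (True, i)))"
      by (simp add: split sum_subtractf sum.distrib)
    show ?thesis
    proof (cases "x = y")
      case True
      have "(\<Sum>i\<in>?I. a r i * a s i) - (\<Sum>i\<in>?I. b r i * b s i)
          = (\<Sum>i<n. (1/2) * ?ae i + (1/2) * ?ea i)"
        unfolding diff using True
        by (intro sum.cong) (cases x; auto simp: a_def b_def r s field_simps)+
      also have "\<dots> = (1/2) * (\<Sum>i<n. ?ae i) + (1/2) * (\<Sum>i<n. ?ea i)"
        by (simp only: sum.distrib sum_distrib_left)
      also have "\<dots> = of_bool (r = s)" using True unfolding rel by (simp add: r s)
      finally show ?thesis by simp
    next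
      case False
      define e :: real where "e = (if x then 1/2 else - 1/2)"
      have "(\<Sum>i\<in>?I. a r i * a s i) - (\<Sum>i\<in>?I. b r i * b s i)
          = (\<Sum>i<n. e * ?ab i + e * ?ce i)"
        unfolding diff using False
        by (intro sum.cong) (cases x; cases y; auto simp: a_def b_def r s e_def field_simps)+
      also have "\<dots> = e * (\<Sum>i<n. ?ab i) + e * (\<Sum>i<n. ?ce i)"
        by (simp only: sum.distrib sum_distrib_left)
      also have "\<dots> = of_bool (r = s)" using False unfolding rel by (simp add: r s)
      finally show ?thesis by simp
    qed
  qed
  have finSI: "finite ?S" "finite ?I" using fin by simp_all
  obtain w where w: "\<And>i. i \<in> ?I \<Longrightarrow> 0 \<le> w i" "\<And>i. i \<in> ?I \<Longrightarrow> w i \<le> 1"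
    "\<And>i. i \<in> ?I \<Longrightarrow> w i \<le> (\<Sum>r\<in>?S. (a r i)\<^sup>2)" "sum w ?I = real (card ?S)"
    using projection_weights[OF finSI gram] by blast
  \<comment> \<open>Columns \<open>i\<close> and \<open>n + i\<close> both belong to
    \<open>d i\<close>; averaging their weights halves the total \<open>2 * card K\<close>.\<close>
  let ?v = "\<lambda>i. (w (False, i) + w (True, i)) / 2"
  show ?thesis
  proof (rule that[of ?v])
    fix i assume "i < n"
    then have i: "(False, i) \<in> ?I" "(True, i) \<in> ?I" by auto
    show "0 \<le> ?v i" "?v i \<le> 1" using w(1,2)[OF i(1)] w(1,2)[OF i(2)] by auto
    have "?v i \<le> ((\<Sum>r\<in>?S. (a r (False, i))\<^sup>2) + (\<Sum>r\<in>?S. (a r (True, i))\<^sup>2)) / 2"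
      using w(3)[OF i(1)] w(3)[OF i(2)] by simp
    also have "\<dots> = (\<Sum>j\<in>K. ((A j i + E j i)\<^sup>2 + (B j i - C j i)\<^sup>2) / 4)"
      by (simp add: split fin sum.distrib[symmetric] sum_divide_distrib)
         (auto simp: a_def power2_eq_square field_simps intro!: sum.cong)
    also have "\<dots> \<le> (\<Sum>j\<in>K. ((A j i)\<^sup>2 + (B j i)\<^sup>2 + (C j i)\<^sup>2 + (E j i)\<^sup>2) / 2)"
    proof (rule sum_mono)
      fix j
      \<comment> \<open>These squares are the discarded contribution of the antilinear part.\<close>
      have "0 \<le> (A j i - E j i)\<^sup>2 + (B j i + C j i)\<^sup>2" by simp
      then show "((A j i + E j i)\<^sup>2 + (B j i - C j i)\<^sup>2) / 4
          \<le> ((A j i)\<^sup>2 + (B j i)\<^sup>2 + (C j i)\<^sup>2 + (E j i)\<^sup>2) / 2"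
        by (simp add: power2_eq_square algebra_simps)
    qed
    finally show "?v i \<le> (\<Sum>j\<in>K. ((A j i)\<^sup>2 + (B j i)\<^sup>2 + (C j i)\<^sup>2 + (E j i)\<^sup>2) / 2)" .
  next
    have "(\<Sum>i<n. ?v i) = sum w ?I / 2" by (simp add: split sum_divide_distrib)
    also have "\<dots> = real (card K)" by (simp add: w(4) card_cartesian_product)
    finally show "(\<Sum>i<n. ?v i) = real (card K)" .
  qed
qed

text \<open>The rows with \<open>x j < t\<close> give weights \<open>v\<close> of total
  \<open>card K\<close> with \<open>\<Sum> d i * v i\<close> at most the sum of these
  \<open>x j\<close>. The shortfall is then at most \<open>\<Sum> v i * (t - d i)\<close>, and
  weights in \<open>[0, 1]\<close> finish the bound.\<close>

lemma symplectic_diagonal_shortfall: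
  fixes A B C E :: "nat \<Rightarrow> nat \<Rightarrow> real" and d :: "nat \<Rightarrow> real"
  assumes d: "\<And>i. i < n \<Longrightarrow> 0 < d i"
    and AB: "\<And>j k. j < n \<Longrightarrow> k < n \<Longrightarrow> (\<Sum>i<n. A j i * B k i - B j i * A k i) = 0"
    and CE: "\<And>j k. j < n \<Longrightarrow> k < n \<Longrightarrow> (\<Sum>i<n. C j i * E k i - E j i * C k i) = 0"
    and AE: "\<And>j k. j < n \<Longrightarrow> k < n \<Longrightarrow> (\<Sum>i<n. A j i * E k i - B j i * C k i) = of_bool (j = k)"
    and x: "\<And>j. j < n \<Longrightarrow>
      x j = sqrt ((\<Sum>i<n. d i * ((A j i)\<^sup>2 + (B j i)\<^sup>2)) * (\<Sum>i<n. d i * ((C j i)\<^sup>2 + (E j i)\<^sup>2)))"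
  shows "(\<Sum>j<n. max 0 (t - x j)) \<le> (\<Sum>i<n. max 0 (t - d i))"
proof -
  define P where "P j = (\<Sum>i<n. d i * ((A j i)\<^sup>2 + (B j i)\<^sup>2))" for j
  define Q where "Q j = (\<Sum>i<n. d i * ((C j i)\<^sup>2 + (E j i)\<^sup>2))" for j
  have d0: "0 \<le> d i" if "i < n" for i using d[OF that] by simp
  have zero: "f i = 0 \<and> g i = 0" if "(\<Sum>i<n. d i * ((f i)\<^sup>2 + (g i)\<^sup>2)) = 0" "i < n" for f g i
  proof -
    have "\<forall>i\<in>{..<n}. d i * ((f i)\<^sup>2 + (g i)\<^sup>2) = 0"
      using that(1) by (subst (asm) sum_nonneg_eq_0_iff) (auto simp: d0)
    then have "d i * ((f i)\<^sup>2 + (g i)\<^sup>2) = 0" using that(2) by blast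
    then show ?thesis using d[OF that(2)] by (simp add: sum_power2_eq_zero_iff)
  qed
  have P0: "0 \<le> P j" and Q0: "0 \<le> Q j" for j
    unfolding P_def Q_def by (auto simp: d0 intro!: sum_nonneg)
  \<comment> \<open>A vanishing diagonal entry would force a zero row, contradicting
    \<open>AE\<close> at \<open>j = k\<close>.\<close>
  have "P j \<noteq> 0 \<and> Q j \<noteq> 0" if "j < n" for j
  proof (rule ccontr)
    assume "\<not> ?thesis"
    then have "P j = 0 \<or> Q j = 0" by simp
    then have "(\<Sum>i<n. A j i * E j i - B j i * C j i) = 0"
    proof
      assume "P j = 0"
      then have "A j i = 0 \<and> B j i = 0" if "i < n" for i using zero that unfolding P_def by blast
      then show ?thesis by simp
    next
      assume "Q j = 0"
      then have "C j i = 0 \<and> E j i = 0" if "i < n" for i using zero that unfolding Q_def by blast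
      then show ?thesis by simp
    qed
    then show False using AE[OF that that] by simp
  qed
  then have pos: "0 < P j" "0 < Q j" if "j < n" for j
    using that P0[of j] Q0[of j] by (metis order_le_less)+
  \<comment> \<open>Scaling row \<open>j\<close> by \<open>c j\<close> and row \<open>n + j\<close> by \<open>1 / c j\<close> keeps the rows symplectic and makes
    the two diagonal entries equal, so that their geometric mean is their arithmetic mean.\<close>
  define c where "c j = sqrt (sqrt (Q j / P j))" for j
  have c: "0 < c j" if "j < n" for j using pos[OF that] by (simp add: c_def)
  have cP: "(c j)\<^sup>2 * P j = x j" "Q j / (c j)\<^sup>2 = x j" if "j < n" for j
  proof -
    have c2: "(c j)\<^sup>2 = sqrt (Q j) / sqrt (P j)"
      using pos[OF that] by (simp add: c_def real_sqrt_divide[symmetric])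
    have xj: "x j = sqrt (P j) * sqrt (Q j)"
      using x[OF that] by (simp add: P_def Q_def real_sqrt_mult)
    have s: "sqrt (P j) * sqrt (P j) = P j" "sqrt (Q j) * sqrt (Q j) = Q j" "sqrt (P j) > 0" "sqrt (Q j) > 0"
      using pos[OF that] by auto
    show "(c j)\<^sup>2 * P j = x j" "Q j / (c j)\<^sup>2 = x j"
      unfolding c2 xj using s by (auto simp: divide_simps)
  qed
  let ?K = "{j \<in> {..<n}. x j < t}"
  let ?A = "\<lambda>j i. c j * A j i" and ?B = "\<lambda>j i. c j * B j i"
  let ?C = "\<lambda>j i. C j i / c j" and ?E = "\<lambda>j i. E j i / c j"
  have R1: "(\<Sum>i<n. ?A j i * ?B k i - ?B j i * ?A k i) = 0" if "j \<in> ?K" "k \<in> ?K" for j k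
  proof -
    have "(\<Sum>i<n. ?A j i * ?B k i - ?B j i * ?A k i) = c j * c k * (\<Sum>i<n. A j i * B k i - B j i * A k i)"
      by (simp add: sum_distrib_left algebra_simps)
    then show ?thesis using AB that by simp
  qed
  have R2: "(\<Sum>i<n. ?C j i * ?E k i - ?E j i * ?C k i) = 0" if "j \<in> ?K" "k \<in> ?K" for j k
  proof -
    have "(\<Sum>i<n. ?C j i * ?E k i - ?E j i * ?C k i) = (\<Sum>i<n. C j i * E k i - E j i * C k i) / (c j * c k)"
      by (simp add: sum_divide_distrib diff_divide_distrib)
    then show ?thesis using CE that by simp
  qed
  have R3: "(\<Sum>i<n. ?A j i * ?E k i - ?B j i * ?C k i) = of_bool (j = k)" if "j \<in> ?K" "k \<in> ?K" for j k
  proof -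
    have "(\<Sum>i<n. ?A j i * ?E k i - ?B j i * ?C k i) = c j / c k * (\<Sum>i<n. A j i * E k i - B j i * C k i)"
      by (simp add: sum_distrib_left algebra_simps)
    then show ?thesis using AE[of j k] c[of k] that by auto
  qed
  have finK: "finite ?K" by simp
  obtain v where v: "\<And>i. i < n \<Longrightarrow> 0 \<le> v i" "\<And>i. i < n \<Longrightarrow> v i \<le> 1"
    "\<And>i. i < n \<Longrightarrow> v i \<le> (\<Sum>j\<in>?K. ((?A j i)\<^sup>2 + (?B j i)\<^sup>2 + (?C j i)\<^sup>2 + (?E j i)\<^sup>2) / 2)"
    "(\<Sum>i<n. v i) = real (card ?K)"
    using symplectic_rows_weights[OF finK R1 R2 R3] by blast
  have "(\<Sum>i<n. d i * v i)
      \<le> (\<Sum>i<n. d i * (\<Sum>j\<in>?K. ((?A j i)\<^sup>2 + (?B j i)\<^sup>2 + (?C j i)\<^sup>2 + (?E j i)\<^sup>2) / 2))"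
    using v(3) d0 by (intro sum_mono mult_left_mono) auto
  also have "\<dots> = (\<Sum>j\<in>?K. \<Sum>i<n. d i * (((?A j i)\<^sup>2 + (?B j i)\<^sup>2 + (?C j i)\<^sup>2 + (?E j i)\<^sup>2) / 2))"
    unfolding sum_distrib_left by (rule sum.swap)
  also have "\<dots> = (\<Sum>j\<in>?K. x j)"
  proof (rule sum.cong)
    fix j assume "j \<in> ?K"
    then have j: "j < n" by simp
    have "(\<Sum>i<n. d i * (((?A j i)\<^sup>2 + (?B j i)\<^sup>2 + (?C j i)\<^sup>2 + (?E j i)\<^sup>2) / 2))
        = (\<Sum>i<n. (c j)\<^sup>2 / 2 * (d i * ((A j i)\<^sup>2 + (B j i)\<^sup>2))
            + 1 / (2 * (c j)\<^sup>2) * (d i * ((C j i)\<^sup>2 + (E j i)\<^sup>2)))"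
      using c[OF j] by (intro sum.cong) (auto simp: power_mult_distrib power_divide field_simps)
    also have "\<dots> = (c j)\<^sup>2 / 2 * P j + 1 / (2 * (c j)\<^sup>2) * Q j"
      by (simp only: sum.distrib sum_distrib_left P_def Q_def)
    also have "\<dots> = ((c j)\<^sup>2 * P j + Q j / (c j)\<^sup>2) / 2" by (simp add: field_simps)
    also have "\<dots> = x j" using cP[OF j] by simp
    finally show "(\<Sum>i<n. d i * (((?A j i)\<^sup>2 + (?B j i)\<^sup>2 + (?C j i)\<^sup>2 + (?E j i)\<^sup>2) / 2)) = x j" .
  qed simp
  finally have dv: "(\<Sum>i<n. d i * v i) \<le> (\<Sum>j\<in>?K. x j)" .
  have "(\<Sum>j<n. max 0 (t - x j)) = (\<Sum>j\<in>?K. t - x j)"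
    by (rule sum.mono_neutral_cong_right) auto
  also have "\<dots> = t * (\<Sum>i<n. v i) - (\<Sum>j\<in>?K. x j)" by (simp add: sum_subtractf v(4))
  also have "\<dots> \<le> t * (\<Sum>i<n. v i) - (\<Sum>i<n. d i * v i)" using dv by simp
  also have "\<dots> = (\<Sum>i<n. v i * (t - d i))"
    by (simp add: sum_distrib_left sum_subtractf[symmetric] algebra_simps)
  also have "\<dots> \<le> (\<Sum>i<n. max 0 (t - d i))"
  proof (rule sum_mono)
    fix i assume "i \<in> {..<n}"
    then have i: "0 \<le> v i" "v i \<le> 1" using v by auto
    have "v i * (t - d i) \<le> v i * max 0 (t - d i)" using i by (intro mult_left_mono) auto
    also have "\<dots> \<le> 1 * max 0 (t - d i)" using i by (intro mult_right_mono) auto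
    finally show "v i * (t - d i) \<le> max 0 (t - d i)" by simp
  qed
  finally show ?thesis .
qed

section \<open>Symplectic congruences in coordinates\<close>

lemma sum_lessThan_add: "(\<Sum>l<n + m. f l) = (\<Sum>l<n. f l) + (\<Sum>i<m. f (n + i))"
  for f :: "nat \<Rightarrow> 'a::comm_monoid_add"
  by (induction m) (simp_all add: ac_simps)

lemma J_mat_carrier: "J_mat n \<in> carrier_mat (2 * n) (2 * n)"
  by (auto simp: J_mat_def)

lemma J_mat_sq: "J_mat n * J_mat n = - 1\<^sub>m (2 * n)"
proof -
  have "J_mat n * J_mat n = four_block_mat (- 1\<^sub>m n) (0\<^sub>m n n) (0\<^sub>m n n) (- 1\<^sub>m n)"
    unfolding J_mat_def by (subst mult_four_block_mat[of _ n n _ n _ n _ _ n _ n]) auto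
  also have "\<dots> = - 1\<^sub>m (2 * n)" by (rule eq_matI) auto
  finally show ?thesis .
qed

text \<open>Since \<open>J\<close> squares to \<open>-1\<close>, the hypothesis makes
  \<open>- J M^T J\<close> a left inverse of the square matrix \<open>M\<close>, hence also a right
  inverse.\<close>

lemma sympl_transpose:
  assumes M: "M \<in> carrier_mat (2 * n) (2 * n)" and eq: "M\<^sup>T * J_mat n * M = J_mat n"
  shows "M * J_mat n * M\<^sup>T = J_mat n"
proof -
  let ?N = "2 * n"
  define J where "J = J_mat n"
  have J: "J \<in> carrier_mat ?N ?N" and JJ: "J * J = - 1\<^sub>m ?N"
    by (simp_all add: J_def J_mat_carrier J_mat_sq)
  note assoc = assoc_mult_mat[of _ ?N ?N _ ?N _ ?N]
  define K where "K = J * (M\<^sup>T * J)"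
  have K: "K \<in> carrier_mat ?N ?N" using J M by (simp add: K_def)
  have "K * M = J * (M\<^sup>T * J * M)" unfolding K_def using J M by (intro assoc) auto
  also have "\<dots> = - 1\<^sub>m ?N" using eq JJ by (simp add: J_def)
  finally have KM: "(- K) * M = 1\<^sub>m ?N" using K M by simp
  have "M * (- K) = 1\<^sub>m ?N"
    by (rule mat_mult_left_right_inverse[OF _ M KM]) (use K in simp)
  then have "- (M * K) = 1\<^sub>m ?N" using K M by simp
  then have MK: "M * K = - 1\<^sub>m ?N" by (metis uminus_uminus_mat)
  define X where "X = M * J * M\<^sup>T"
  have X: "X \<in> carrier_mat ?N ?N" using J M by (simp add: X_def)
  have "M * K = M * J * (M\<^sup>T * J)"
    unfolding K_def using J M by (intro assoc[symmetric]) auto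
  also have "\<dots> = X * J" unfolding X_def using J M by (intro assoc[symmetric]) auto
  finally have XJ: "X * J = - 1\<^sub>m ?N" using MK by simp
  have "- X = X * (J * J)" using X by (simp add: JJ)
  also have "\<dots> = X * J * J" using X J by (intro assoc[symmetric])
  also have "\<dots> = - J" using J by (simp add: XJ)
  finally show ?thesis by (simp add: X_def J_def)
qed

lemma sum_eq_single:
  assumes "finite I" "i \<in> I" "\<And>l. l \<in> I \<Longrightarrow> l \<noteq> i \<Longrightarrow> f l = 0"
  shows "sum f I = f i"
  using sum.mono_neutral_right[of I "{i}" f] assms by auto

lemma congruence_index:
  fixes M X :: "real mat"
  assumes "M \<in> carrier_mat N N" "X \<in> carrier_mat N N" "r < N" "k < N"
  shows "(M * X * M\<^sup>T) $$ (r, k) = (\<Sum>i<N. \<Sum>l<N. M $$ (r, i) * X $$ (i, l) * M $$ (k, l))"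
  using assms by (simp add: scalar_prod_def atLeast0LessThan sum_distrib_left mult.assoc)

lemma congruence_J_index:
  assumes M: "M \<in> carrier_mat (2 * n) (2 * n)" and rk: "r < 2 * n" "k < 2 * n"
  shows "(M * J_mat n * M\<^sup>T) $$ (r, k)
    = (\<Sum>i<n. M $$ (r, i) * M $$ (k, n + i) - M $$ (r, n + i) * M $$ (k, i))"
proof -
  have "(\<Sum>l<n. M $$ (r, i) * J_mat n $$ (i, l) * M $$ (k, l)) = 0"
    "(\<Sum>l<n. M $$ (r, i) * J_mat n $$ (i, n + l) * M $$ (k, n + l)) = M $$ (r, i) * M $$ (k, n + i)"
    "(\<Sum>l<n. M $$ (r, n + i) * J_mat n $$ (n + i, l) * M $$ (k, l)) = - (M $$ (r, n + i) * M $$ (k, i))"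
    "(\<Sum>l<n. M $$ (r, n + i) * J_mat n $$ (n + i, n + l) * M $$ (k, n + l)) = 0" if "i < n" for i
    using that by (subst sum_eq_single[of _ i]; simp add: J_mat_def)+
  then show ?thesis
    unfolding congruence_index[OF M J_mat_carrier rk] mult_2 sum_lessThan_add
    by (simp add: sum.distrib sum_subtractf sum_negf)
qed

lemma congruence_diag_index:
  assumes M: "M \<in> carrier_mat (2 * n) (2 * n)" and rk: "r < 2 * n" "k < 2 * n" and n: "length d = n"
  shows "(M * four_block_mat (diag_of d) (0\<^sub>m n n) (0\<^sub>m n n) (diag_of d) * M\<^sup>T) $$ (r, k)
    = (\<Sum>i<n. d ! i * (M $$ (r, i) * M $$ (k, i) + M $$ (r, n + i) * M $$ (k, n + i)))"
proof -
  let ?X = "four_block_mat (diag_of d) (0\<^sub>m n n) (0\<^sub>m n n) (diag_of d)"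
  have X: "?X \<in> carrier_mat (2 * n) (2 * n)" using n by (auto simp: diag_of_def)
  have "(\<Sum>l<n. M $$ (r, i) * ?X $$ (i, l) * M $$ (k, l)) = d ! i * (M $$ (r, i) * M $$ (k, i))"
    "(\<Sum>l<n. M $$ (r, i) * ?X $$ (i, n + l) * M $$ (k, n + l)) = 0"
    "(\<Sum>l<n. M $$ (r, n + i) * ?X $$ (n + i, l) * M $$ (k, l)) = 0"
    "(\<Sum>l<n. M $$ (r, n + i) * ?X $$ (n + i, n + l) * M $$ (k, n + l))
      = d ! i * (M $$ (r, n + i) * M $$ (k, n + i))" if "i < n" for i
    using that n by (subst sum_eq_single[of _ i]; simp add: diag_of_def)+
  then show ?thesis
    unfolding congruence_index[OF M X rk] mult_2 sum_lessThan_add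
    by (simp add: sum.distrib distrib_left)
qed

lemma Delta_s_orbit:
  assumes M: "M \<in> carrier_mat (2 * length d) (2 * length d)"
    and A: "A = M * four_block_mat (diag_of d) (0\<^sub>m (length d) (length d)) (0\<^sub>m (length d) (length d)) (diag_of d) * M\<^sup>T"
    and j: "j < length d"
  shows "Delta_s (length d) A ! j =
    sqrt ((\<Sum>i<length d. d ! i * ((M $$ (j, i))\<^sup>2 + (M $$ (j, length d + i))\<^sup>2))
        * (\<Sum>i<length d. d ! i * ((M $$ (length d + j, i))\<^sup>2 + (M $$ (length d + j, length d + i))\<^sup>2)))"
  using j by (simp add: Delta_s_def A congruence_diag_index[OF M _ _ refl] power2_eq_square)

lemma Sigma_d_eq_maj_on:
  "x \<in> Sigma_d d \<longleftrightarrow> length x = length d \<and>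
    (\<exists>z. maj_on {..<length d} z ((!) d) \<and> (\<forall>j<length d. z j \<le> x ! j))"
proof
  assume "x \<in> Sigma_d d"
  then show "length x = length d \<and> (\<exists>z. maj_on {..<length d} z ((!) d) \<and> (\<forall>j<length d. z j \<le> x ! j))"
    unfolding Sigma_d_def majorised_iff_maj_on le_vec_def by auto
next
  assume R: "length x = length d \<and> (\<exists>z. maj_on {..<length d} z ((!) d) \<and> (\<forall>j<length d. z j \<le> x ! j))"
  then obtain z where z: "maj_on {..<length d} z ((!) d)" "\<forall>j<length d. z j \<le> x ! j" by blast
  let ?z = "map z [0..<length d]"
  have "maj_on {..<length d} ((!) ?z) ((!) d)" using z(1) by (simp add: maj_on_def)
  then show "x \<in> Sigma_d d"
    using R z(2) unfolding Sigma_d_def majorised_iff_maj_on le_vec_def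
    by (intro UN_I[of ?z]) auto
qed

text \<open>The product of the shear with blocks \<open>1, S; 0, 1\<close>, where
  \<open>S = diag(s)\<close>, and \<open>diag(Q, Q)\<close>.\<close>

definition sheared_mat :: "nat \<Rightarrow> (nat \<Rightarrow> real) \<Rightarrow> (nat \<Rightarrow> nat \<Rightarrow> real) \<Rightarrow> real mat" where
  "sheared_mat n s q = mat (2 * n) (2 * n) (\<lambda>(r, i).
     if r < n then (if i < n then q r i else s r * q r (i - n))
     else (if i < n then 0 else q (r - n) (i - n)))"

lemma sheared_mat_in_Sp:
  assumes q: "orthonormal_rows n q"
  shows "sheared_mat n s q \<in> Sp n"
proof -
  define M where "M = sheared_mat n s q"
  have M: "M \<in> carrier_mat (2 * n) (2 * n)" by (simp add: M_def sheared_mat_def)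
  have ix: "M $$ (j, i) = q j i" "M $$ (j, n + i) = s j * q j i" "M $$ (n + j, i) = 0"
    "M $$ (n + j, n + i) = q j i" if "j < n" "i < n" for j i
    using that by (auto simp: M_def sheared_mat_def)
  have ip: "(\<Sum>i<n. q j i * q k i) = of_bool (j = k)" if "j < n" "k < n" for j k
    using q that by (simp add: orthonormal_rows_def)
  have J: "J_mat n $$ (i, l) = 0" "J_mat n $$ (i, n + l) = of_bool (i = l)"
    "J_mat n $$ (n + i, l) = - of_bool (i = l)" "J_mat n $$ (n + i, n + l) = 0" if "i < n" "l < n" for i l
    using that by (auto simp: J_mat_def)
  have "M * J_mat n * M\<^sup>T = J_mat n"
  proof (rule eq_matI)
    fix r k assume "r < dim_row (J_mat n)" "k < dim_col (J_mat n)"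
    then have rk: "r < 2 * n" "k < 2 * n" using J_mat_carrier[of n] by auto
    have split: "(\<exists>j<n. r = j) \<or> (\<exists>j<n. r = n + j)" if "r < 2 * n" for r
      using that by (metis add.commute le_Suc_ex mult_2 nat_add_left_cancel_less not_le)
    \<comment> \<open>This product of two upper rows vanishes: off the diagonal by orthogonality, on
      it because \<open>s k = s j\<close>.\<close>
    have shear: "(\<Sum>i<n. q j i * (s k * q k i) - s j * q j i * q k i) = (s k - s j) * (\<Sum>i<n. q j i * q k i)"
      for j k by (simp add: sum_distrib_left algebra_simps)
    show "(M * J_mat n * M\<^sup>T) $$ (r, k) = J_mat n $$ (r, k)"
      unfolding congruence_J_index[OF M rk]
      using split[OF rk(1)] split[OF rk(2)]
      by (elim disjE exE conjE) (auto simp: ix ip J shear sum_negf)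
  qed (use M J_mat_carrier[of n] in auto)
  then have "M\<^sup>T * J_mat n * M = J_mat n"
    using sympl_transpose[of "M\<^sup>T" n] M by simp
  then show ?thesis using M by (simp add: Sp_def M_def)
qed

lemma Delta_s_orbit_subset:
  assumes "\<forall>i < length d. d ! i > 0"
  shows "Delta_s (length d) ` sympl_orbit d \<subseteq> Sigma_d d"
proof
  let ?n = "length d"
  let ?X = "four_block_mat (diag_of d) (0\<^sub>m ?n ?n) (0\<^sub>m ?n ?n) (diag_of d)"
  fix x assume "x \<in> Delta_s ?n ` sympl_orbit d"
  then obtain M where M: "M \<in> Sp ?n" and x: "x = Delta_s ?n (M * ?X * M\<^sup>T)"
    by (auto simp: sympl_orbit_def Let_def)
  have Mc: "M \<in> carrier_mat (2 * ?n) (2 * ?n)" using M by (simp add: Sp_def)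
  have "M * J_mat ?n * M\<^sup>T = J_mat ?n" using M by (intro sympl_transpose) (auto simp: Sp_def)
  then have rel: "(\<Sum>i<?n. M $$ (r, i) * M $$ (k, ?n + i) - M $$ (r, ?n + i) * M $$ (k, i))
      = J_mat ?n $$ (r, k)" if "r < 2 * ?n" "k < 2 * ?n" for r k
    using congruence_J_index[OF Mc that] by simp
  have "(\<Sum>j<?n. max 0 (t - x ! j)) \<le> (\<Sum>i<?n. max 0 (t - d ! i))" for t
  proof (rule symplectic_diagonal_shortfall[where A = "\<lambda>j i. M $$ (j, i)" and B = "\<lambda>j i. M $$ (j, ?n + i)"
        and C = "\<lambda>j i. M $$ (?n + j, i)" and E = "\<lambda>j i. M $$ (?n + j, ?n + i)"])
    show "x ! j = sqrt ((\<Sum>i<?n. d ! i * ((M $$ (j, i))\<^sup>2 + (M $$ (j, ?n + i))\<^sup>2))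
        * (\<Sum>i<?n. d ! i * ((M $$ (?n + j, i))\<^sup>2 + (M $$ (?n + j, ?n + i))\<^sup>2)))" if "j < ?n" for j
      unfolding x by (rule Delta_s_orbit[OF Mc refl that])
  qed (use assms in \<open>auto simp: rel J_mat_def\<close>)
  then obtain z where "maj_on {..<?n} z ((!) d)" "\<And>i. i < ?n \<Longrightarrow> z i \<le> x ! i"
    using maj_on_truncate[of "{..<?n}" "(!) x" "(!) d"] by auto
  then show "x \<in> Sigma_d d" unfolding Sigma_d_eq_maj_on by (auto simp: x Delta_s_def)
qed

lemma Sigma_d_subset:
  assumes "\<forall>i < length d. d ! i > 0"
  shows "Sigma_d d \<subseteq> Delta_s (length d) ` sympl_orbit d"
proof
  let ?n = "length d"
  let ?X = "four_block_mat (diag_of d) (0\<^sub>m ?n ?n) (0\<^sub>m ?n ?n) (diag_of d)"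
  fix x assume "x \<in> Sigma_d d"
  then obtain z where len: "length x = ?n" and z: "maj_on {..<?n} z ((!) d)"
    and zx: "\<And>j. j < ?n \<Longrightarrow> z j \<le> x ! j"
    unfolding Sigma_d_eq_maj_on by blast
  obtain q where q: "orthonormal_rows ?n q" and zq: "\<And>j. j < ?n \<Longrightarrow> z j = (\<Sum>i<?n. d ! i * (q j i)\<^sup>2)"
    using schur_horn_existence[OF z] by blast
  \<comment> \<open>Row \<open>j\<close> of \<open>q\<close> is not zero and \<open>d\<close> is
    positive; this permits the division by \<open>z j\<close> below.\<close>
  have zpos: "0 < z j" if "j < ?n" for j
  proof -
    have "(\<Sum>i<?n. q j i * q j i) \<noteq> 0" using q that by (simp add: orthonormal_rows_def)
    then obtain i where i: "i \<in> {..<?n}" "q j i * q j i \<noteq> 0" by (rule sum.not_neutral_contains_not_neutral)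
    then have "0 < d ! i * (q j i)\<^sup>2" using assms by simp
    moreover have "0 \<le> d ! l * (q j l)\<^sup>2" if "l \<in> {..<?n}" for l using assms that by (simp add: less_imp_le)
    ultimately show ?thesis unfolding zq[OF that] using i(1) by (intro sum_pos2[of _ i]) auto
  qed
  \<comment> \<open>Solves \<open>sqrt (1 + s^2) * z = x\<close>; the radicand is nonnegative
    because \<open>0 < z j\<close> and \<open>z j \<le> x ! j\<close>.\<close>
  define s where "s j = sqrt ((x ! j / z j)\<^sup>2 - 1)" for j
  have s: "z j * (1 + (s j)\<^sup>2) * z j = (x ! j)\<^sup>2" if "j < ?n" for j
  proof -
    define y where "y = x ! j / z j"
    have "1 \<le> y" using zx[OF that] zpos[OF that] by (simp add: y_def)
    then have "(s j)\<^sup>2 = y\<^sup>2 - 1" by (simp add: s_def y_def[symmetric] one_le_power)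
    then have "z j * (1 + (s j)\<^sup>2) * z j = (y * z j)\<^sup>2" by (simp add: power2_eq_square)
    also have "y * z j = x ! j" using zpos[OF that] by (simp add: y_def)
    finally show ?thesis .
  qed
  define M where "M = sheared_mat ?n s q"
  have M: "M \<in> Sp ?n" unfolding M_def by (rule sheared_mat_in_Sp[OF q])
  then have Mc: "M \<in> carrier_mat (2 * ?n) (2 * ?n)" by (simp add: Sp_def)
  have "Delta_s ?n (M * ?X * M\<^sup>T) = x"
  proof (rule nth_equalityI)
    fix j assume "j < length (Delta_s ?n (M * ?X * M\<^sup>T))"
    then have j: "j < ?n" by (simp add: Delta_s_def)
    have "(\<Sum>i<?n. d ! i * ((M $$ (j, i))\<^sup>2 + (M $$ (j, ?n + i))\<^sup>2))
        = (\<Sum>i<?n. d ! i * (q j i)\<^sup>2 * (1 + (s j)\<^sup>2))"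
      using j by (intro sum.cong) (simp_all add: M_def sheared_mat_def power_mult_distrib algebra_simps)
    also have "\<dots> = z j * (1 + (s j)\<^sup>2)"
      unfolding sum_distrib_right[symmetric] zq[OF j] ..
    finally have 1: "(\<Sum>i<?n. d ! i * ((M $$ (j, i))\<^sup>2 + (M $$ (j, ?n + i))\<^sup>2)) = z j * (1 + (s j)\<^sup>2)" .
    have 2: "(\<Sum>i<?n. d ! i * ((M $$ (?n + j, i))\<^sup>2 + (M $$ (?n + j, ?n + i))\<^sup>2)) = z j"
      unfolding zq[OF j] using j by (intro sum.cong) (simp_all add: M_def sheared_mat_def)
    have "0 \<le> x ! j" using zpos[OF j] zx[OF j] by simp
    then show "Delta_s ?n (M * ?X * M\<^sup>T) ! j = x ! j"
      unfolding Delta_s_orbit[OF Mc refl j] 1 2 s[OF j] by simp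
  qed (simp add: Delta_s_def len)
  moreover have "M * ?X * M\<^sup>T \<in> sympl_orbit d" using M by (auto simp: sympl_orbit_def Let_def)
  ultimately show "x \<in> Delta_s ?n ` sympl_orbit d" by (metis imageI)
qed

theorem theorem2:
  fixes d :: "real list"
  assumes "\<forall>i < length d. d ! i > 0"
  shows "Delta_s (length d) ` sympl_orbit d = Sigma_d d"
  using Delta_s_orbit_subset[OF assms] Sigma_d_subset[OF assms] by (rule equalityI)

end
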